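(* Let $f:(\mathbb{R}^2,0)\to(\mathbb{R}^2,0)$ be a continuous tame map-germ with $\widehat{B}(f)=\{0\}$ and $f^{-1}(0)=\{0\}$. If the mapping $$df:(\mathbb{R}^2\setminus\{0\},0)\to \mathrm{GL}(2,\mathbb{R})$$ is null homotopic, then $f$ is a homeomorphism (germ).
   Context: $\widehat{B}(f)$ is the set of points at which $f$ is not differentiable, or is differentiable with singular differential. A continuous map is tame if its graph is subanalytic or is definable in some o-minimal structure on $(\mathbb{R},+,\cdot,<)$; a germ is tame if it has a tame representative. All statements are about germs at $0$: the equalities hold on a small open disc $D$ centred at $0$, and null homotopic means that on some such disc the map $D\setminus\{0\}\to\mathrm{GL}(2,\mathbb{R})$, $x\mapsto df(x)$, is continuous and homotopic to a constant map. A map-germ $f$ at $0$ is a homeomorphism if it has a representative which is a homeomorphism from an open neighbourhood of $0$ onto an open neighbourhood of $0$. *)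

theory Defs
  imports "HOL-Analysis.Analysis" "HOL-Library.More_List"
begin

text \<open>
  Subanalytic sets and definable sets involve all the spaces \<open>\<real>\<^sup>n\<close> at once, so \<open>n\<close> cannot be a type.
  We use the library's \<^const>\<open>Euclidean_space\<close>, whose points are the functions
  \<open>x :: nat \<Rightarrow> real\<close> with \<open>x i = 0\<close> for all \<open>i \<ge> n\<close>. Coordinates are numbered from 0.
\<close>

abbreviation Rn :: "nat \<Rightarrow> (nat \<Rightarrow> real) set"
  where "Rn n \<equiv> topspace (Euclidean_space n)"

text \<open>Projection of \<open>\<real>\<^sup>n\<^sup>+\<^sup>m\<close> onto its first \<open>n\<close> coordinates.\<close>

definition trunc :: "nat \<Rightarrow> (nat \<Rightarrow> real) \<Rightarrow> nat \<Rightarrow> real"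
  where "trunc n x = (\<lambda>i. if i < n then x i else 0)"


section \<open>Subanalytic sets\<close>

text \<open>
  Near every point \<open>a\<close> of \<open>U\<close>, \<open>g\<close> is the sum of a power series in \<open>x - a\<close>, indexed by the
  multi-indices \<open>\<alpha>\<close> of length \<open>n\<close>. For real families \<^const>\<open>has_sum\<close> is absolute convergence.
\<close>

definition real_analytic_on :: "nat \<Rightarrow> (nat \<Rightarrow> real) set \<Rightarrow> ((nat \<Rightarrow> real) \<Rightarrow> real) \<Rightarrow> bool"
  where "real_analytic_on n U g \<longleftrightarrow>
    (\<forall>a\<in>U. \<exists>r>0. \<exists>c :: (nat \<Rightarrow> nat) \<Rightarrow> real.
       \<forall>x\<in>Rn n. (\<forall>i<n. \<bar>x i - a i\<bar> < r) \<longrightarrow>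
         ((\<lambda>\<alpha>. c \<alpha> * (\<Prod>i<n. (x i - a i) ^ \<alpha> i)) has_sum g x) {\<alpha>. \<forall>i\<ge>n. \<alpha> i = 0})"

text \<open>
  Locally a finite union of sets given by finitely many equations \<open>p = 0\<close> and strict inequalities
  \<open>q > 0\<close> between analytic functions. The local condition is imposed at every point of \<open>\<real>\<^sup>n\<close>, not
  only at the points of \<open>X\<close>.
\<close>

definition semianalytic :: "nat \<Rightarrow> (nat \<Rightarrow> real) set \<Rightarrow> bool"
  where "semianalytic n X \<longleftrightarrow> X \<subseteq> Rn n \<and>
    (\<forall>a\<in>Rn n. \<exists>U. openin (Euclidean_space n) U \<and> a \<in> U \<and>
       (\<exists>F :: (((nat \<Rightarrow> real) \<Rightarrow> real) set \<times> ((nat \<Rightarrow> real) \<Rightarrow> real) set) set.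
          finite F \<and>
          (\<forall>(P, Q)\<in>F. finite P \<and> finite Q \<and> (\<forall>g\<in>P \<union> Q. real_analytic_on n U g)) \<and>
          X \<inter> U = (\<Union>(P, Q)\<in>F. {x\<in>U. (\<forall>p\<in>P. p x = 0) \<and> (\<forall>q\<in>Q. q x > 0)})))"

text \<open>Locally the projection of a relatively compact semianalytic set.\<close>

definition subanalytic :: "nat \<Rightarrow> (nat \<Rightarrow> real) set \<Rightarrow> bool"
  where "subanalytic n X \<longleftrightarrow> X \<subseteq> Rn n \<and>
    (\<forall>a\<in>Rn n. \<exists>U. openin (Euclidean_space n) U \<and> a \<in> U \<and>
       (\<exists>m B. semianalytic (n + m) B \<and>
          compactin (Euclidean_space (n + m)) (Euclidean_space (n + m) closure_of B) \<and>
          X \<inter> U = trunc n ` B))"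


section \<open>O-minimal structures\<close>

text \<open>
  \<open>S n\<close> is the collection of definable subsets of \<open>\<real>\<^sup>n\<close>. Definability is with parameters: every
  singleton of \<open>\<real>\<close> is in \<open>S 1\<close>. In \<open>o_minimal\<close>, \<^const>\<open>is_interval\<close> covers bounded and
  unbounded intervals of all kinds, and one-point sets.
\<close>

locale o_minimal_structure =
  fixes S :: "nat \<Rightarrow> (nat \<Rightarrow> real) set set"
  assumes subset: "A \<in> S n \<Longrightarrow> A \<subseteq> Rn n"
    and empty: "{} \<in> S n"
    and union: "\<lbrakk>A \<in> S n; B \<in> S n\<rbrakk> \<Longrightarrow> A \<union> B \<in> S n"
    and complement: "A \<in> S n \<Longrightarrow> Rn n - A \<in> S n"
    and product_right: "A \<in> S n \<Longrightarrow> {x\<in>Rn (Suc n). trunc n x \<in> A} \<in> S (Suc n)"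
    and product_left: "A \<in> S n \<Longrightarrow> {x\<in>Rn (Suc n). x \<circ> Suc \<in> A} \<in> S (Suc n)"
    and diagonal: "\<lbrakk>i < n; j < n\<rbrakk> \<Longrightarrow> {x\<in>Rn n. x i = x j} \<in> S n"
    and projection: "A \<in> S (Suc n) \<Longrightarrow> trunc n ` A \<in> S n"
    and order: "{x\<in>Rn 2. x 0 < x 1} \<in> S 2"
    and addition: "{x\<in>Rn 3. x 0 + x 1 = x 2} \<in> S 3"
    and multiplication: "{x\<in>Rn 3. x 0 * x 1 = x 2} \<in> S 3"
    and o_minimal: "A \<in> S 1 \<longleftrightarrow>
      A \<subseteq> Rn 1 \<and> (\<exists>\<I>. finite \<I> \<and> (\<forall>I\<in>\<I>. is_interval I) \<and> (\<lambda>x. x 0) ` A = \<Union>\<I>)"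


section \<open>Germs of plane maps\<close>

text \<open>
  A germ at 0 is represented by a total function; every notion below, apart from \<open>graph_on\<close>,
  \<open>tame_on\<close> and the pointwise \<open>B_hat\<close>, depends only on its values near 0.
\<close>

definition graph_on :: "(real^2) set \<Rightarrow> (real^2 \<Rightarrow> real^2) \<Rightarrow> (nat \<Rightarrow> real) set"
  where "graph_on U f = (\<lambda>x. nth_default 0 [x $ 1, x $ 2, f x $ 1, f x $ 2]) ` U"

definition tame_on :: "(real^2) set \<Rightarrow> (real^2 \<Rightarrow> real^2) \<Rightarrow> bool"
  where "tame_on U f \<longleftrightarrow>
    subanalytic 4 (graph_on U f) \<or> (\<exists>S. o_minimal_structure S \<and> graph_on U f \<in> S 4)"

definition continuous_tame_germ :: "(real^2 \<Rightarrow> real^2) \<Rightarrow> bool"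
  where "continuous_tame_germ f \<longleftrightarrow>
    (\<exists>U. open U \<and> 0 \<in> U \<and> continuous_on U f \<and> tame_on U f)"

definition B_hat :: "(real^2 \<Rightarrow> real^2) \<Rightarrow> (real^2) set"
  where "B_hat f = {x. \<not> f differentiable (at x) \<or> \<not> invertible (jacobian f (at x))}"

definition GL2 :: "(real^2^2) set"
  where "GL2 = {A. invertible A}"

definition null_homotopic_differential :: "(real^2 \<Rightarrow> real^2) \<Rightarrow> bool"
  where "null_homotopic_differential f \<longleftrightarrow>
    (\<exists>r>0. (\<forall>x\<in>ball 0 r - {0}. f differentiable (at x)) \<and>
       continuous_on (ball 0 r - {0}) (\<lambda>x. jacobian f (at x)) \<and>
       (\<exists>A. homotopic_with_canon (\<lambda>_. True) (ball 0 r - {0}) GL2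
              (\<lambda>x. jacobian f (at x)) (\<lambda>_. A)))"

definition homeomorphism_germ :: "(real^2 \<Rightarrow> real^2) \<Rightarrow> bool"
  where "homeomorphism_germ f \<longleftrightarrow>
    (\<exists>U V g. open U \<and> 0 \<in> U \<and> open V \<and> 0 \<in> V \<and> homeomorphism U V f g)"

end

theory Submission
  imports Defs "HOL-Complex_Analysis.Complex_Analysis"
begin

text \<open>
  Near 0 the map \<open>f\<close> is a proper local homeomorphism of a punctured neighbourhood \<open>V\<close> onto a punctured
  disc, hence a covering, and it suffices to show that it has degree one. Lift the radial
  contraction \<open>(1 - t T) f(x)\<close> to paths \<open>k(t, x)\<close> in \<open>V\<close> starting at the points \<open>x\<close> of a small circle. Then
  \<open>k(t, x) \<noteq> x\<close> for \<open>t > 0\<close>, the point \<open>k(1, x)\<close> lies inside the circle, and as maps from the circle to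
  \<open>\<real>\<^sup>2 - {0}\<close> the following are homotopic, for \<open>t\<close> small:
  \<open>f(x)\<close>, \<open>f(x) - f(k(t, x))\<close>, \<open>df(x)(x - k(t, x))\<close>, \<open>A (x - k(t, x))\<close>, \<open>A (x - k(1, x))\<close>, \<open>A x\<close>,
  where \<open>A\<close> is the constant to which \<open>df\<close> is homotopic. So every loop \<open>f \<circ> \<gamma>\<close> is homotopic to the image
  of a closed circular loop, and by monodromy \<open>\<gamma>\<close> is closed.
\<close>

section \<open>Proper local homeomorphisms are coverings\<close>

text \<open>Properness makes \<open>p\<close> a closed map with compact fibres; the fibres are also
  discrete, hence finite. Disjoint charts around the points of a fibre become sheets once the base
  is shrunk away from the closed image of everything outside the charts.\<close>

lemma proper_local_homeomorphism_imp_covering_space: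
  fixes p :: "'a::heine_borel \<Rightarrow> 'b::heine_borel"
  assumes contp: "continuous_on C p" and im: "p ` C \<subseteq> S"
    and loc: "\<And>x. x \<in> C \<Longrightarrow> \<exists>U q. openin (top_of_set C) U \<and> x \<in> U \<and>
                openin (top_of_set S) (p ` U) \<and> homeomorphism U (p ` U) p q"
    and proper: "\<And>K. K \<subseteq> S \<Longrightarrow> compact K \<Longrightarrow> compact (C \<inter> p -` K)"
    and "connected S" "C \<noteq> {}"
  shows "covering_space C p S"
proof -
  have closed_map: "closedin (top_of_set S) (p ` K)" if "closedin (top_of_set C) K" for K
    using proper_map[OF that] proper im by (metis image_subset_iff_funcset)
  obtain W where W: "\<And>x. x \<in> C \<Longrightarrow> openin (top_of_set C) (W x) \<and> x \<in> W x \<and>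
      openin (top_of_set S) (p ` W x) \<and> (\<exists>q. homeomorphism (W x) (p ` W x) p q)"
    using loc by metis
  have open_map: "openin (top_of_set S) (p ` U)" if U: "openin (top_of_set C) U" for U
  proof (subst openin_subopen, clarify)
    fix x assume "x \<in> U"
    with U have "x \<in> C" using openin_imp_subset by blast
    then obtain q where q: "homeomorphism (W x) (p ` W x) p q" using W by blast
    have "openin (top_of_set (W x)) (U \<inter> W x)"
      using U W[OF \<open>x \<in> C\<close>] openin_imp_subset
      by (metis openin_Int openin_subset_trans inf_le2)
    then have "openin (top_of_set (p ` W x)) (p ` (U \<inter> W x))"
      using homeomorphism_imp_open_map[OF q] by blast
    then have "openin (top_of_set S) (p ` (U \<inter> W x))"
      using W[OF \<open>x \<in> C\<close>] openin_trans by blast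
    then show "\<exists>T. openin (top_of_set S) T \<and> p x \<in> T \<and> T \<subseteq> p ` U"
      using \<open>x \<in> U\<close> W[OF \<open>x \<in> C\<close>] by (intro exI[of _ "p ` (U \<inter> W x)"]) blast
  qed
  have "p ` C = S"
  proof -
    have "openin (top_of_set S) (p ` C)" "closedin (top_of_set S) (p ` C)"
      using open_map closed_map by auto
    then show ?thesis
      using \<open>connected S\<close> \<open>C \<noteq> {}\<close> unfolding connected_clopen by blast
  qed
  moreover have "\<exists>T. y \<in> T \<and> openin (top_of_set S) T \<and>
                    (\<exists>v. \<Union>v = C \<inter> p -` T \<and>
                        (\<forall>u \<in> v. openin (top_of_set C) u) \<and>
                        pairwise disjnt v \<and>
                        (\<forall>u \<in> v. \<exists>q. homeomorphism u T p q))" if "y \<in> S" for y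
  proof -
    define F where "F = C \<inter> p -` {y}"
    have FC: "F \<subseteq> C" by (auto simp: F_def)
    have inj: "inj_on p (W x)" if "x \<in> C" for x
      using W[OF that] homeomorphism_apply1 by (blast intro: inj_on_inverseI)
    have "compact F" unfolding F_def using proper[of "{y}"] that by simp
    obtain O' where O': "\<And>x. x \<in> C \<Longrightarrow> open (O' x) \<and> W x = C \<inter> O' x"
    proof -
      have "\<exists>T. open T \<and> W x = C \<inter> T" if "x \<in> C" for x
        using W[OF that] by (simp add: openin_open)
      then show ?thesis using that by metis
    qed
    \<comment> \<open>By injectivity of \<open>p\<close> on \<open>W d\<close>, this chart meets the
      fibre in \<open>d\<close> only, so the centres of a finite subcover exhaust
      \<open>F\<close>.\<close>
    have "finite F"
    proof -
      have "F \<subseteq> (\<Union>x\<in>F. O' x)" using FC O' W by blast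
      then obtain D where D: "D \<subseteq> F" "finite D" "F \<subseteq> (\<Union>x\<in>D. O' x)"
        using O' FC by (blast intro: compactE_image[OF \<open>compact F\<close>, of F O'])
      have "F \<subseteq> D"
      proof
        fix x assume "x \<in> F"
        then obtain d where d: "d \<in> D" "x \<in> O' d" using D by blast
        then have "x \<in> W d" "d \<in> W d" "p x = p d"
          using O'[of d] W[of d] FC D \<open>x \<in> F\<close> by (auto simp: F_def)
        then have "x = d" using inj[of d] d D FC by (auto dest: inj_onD)
        with d show "x \<in> D" by simp
      qed
      with D show ?thesis using finite_subset by blast
    qed
    then have "uniform_discrete F"
      using uniform_discrete_finite_iff[of F] by blast
    then obtain e where "e > 0" and e: "\<And>x x'. x \<in> F \<Longrightarrow> x' \<in> F \<Longrightarrow> dist x x' < e \<Longrightarrow> x = x'"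
      unfolding uniform_discrete_def by blast
    \<comment> \<open>Radius \<open>e/2\<close>, half the separation of the fibre, makes the charts
      disjoint.\<close>
    define V where "V x = W x \<inter> ball x (e/2)" for x
    have V: "openin (top_of_set C) (V x)" "x \<in> V x" "V x \<subseteq> W x" "inj_on p (V x)" if "x \<in> F" for x
      using W[of x] FC that \<open>e > 0\<close> inj[of x] by (auto simp: V_def openin_Int_open intro: inj_on_subset)
    have disj: "x = x'" if "x \<in> F" "x' \<in> F" "z \<in> V x" "z \<in> V x'" for x x' z
    proof -
      have "dist x x' < e"
        using that by (rule_tac dist_triangle_half_r[of z]) (simp_all add: V_def dist_commute)
      with e that show ?thesis by blast
    qed
    define K where "K = C - (\<Union>x\<in>F. V x)"
    \<comment> \<open>Removing the image of \<open>K\<close> forces all preimages of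
      \<open>T\<close> into the charts; intersecting the images of the charts makes each chart reach
      all of \<open>T\<close>. The factor \<open>S\<close> is there for an empty fibre, where the
      intersection alone is the whole type.\<close>
    define T where "T = (S \<inter> \<Inter>((\<lambda>x. p ` V x) ` F)) - p ` K"
    have "closedin (top_of_set C) K"
      unfolding K_def using V by (intro closedin_diff openin_Union) auto
    then have "closedin (top_of_set S) (p ` K)" by (rule closed_map)
    moreover have "openin (top_of_set S) (S \<inter> \<Inter>((\<lambda>x. p ` V x) ` F))"
    proof (cases "F = {}")
      case False
      then have "openin (top_of_set S) (\<Inter>((\<lambda>x. p ` V x) ` F))"
        using \<open>finite F\<close> V open_map by (intro openin_Inter) auto
      then show ?thesis by auto
    qed auto
    ultimately have opT: "openin (top_of_set S) T"
      unfolding T_def by (rule openin_diff[rotated])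
    have "y \<in> T"
      using that V by (auto simp: T_def K_def F_def)
    have TV: "T \<subseteq> p ` V x" if "x \<in> F" for x using that by (auto simp: T_def)
    define v where "v = (\<lambda>x. V x \<inter> p -` T) ` F"
    have "\<Union>v = C \<inter> p -` T"
    proof -
      have "V x \<subseteq> C" if "x \<in> F" for x using V(1)[OF that] openin_imp_subset by blast
      then show ?thesis by (auto simp: v_def T_def K_def)
    qed
    moreover have "openin (top_of_set C) u" if "u \<in> v" for u
    proof -
      have "openin (top_of_set C) (C \<inter> p -` T)"
        using continuous_openin_preimage[OF contp _ opT] im by auto
      then have "openin (top_of_set C) (V x \<inter> (C \<inter> p -` T))" if "x \<in> F" for x
        using V(1)[OF that] by (rule openin_Int[rotated])
      moreover have "V x \<inter> (C \<inter> p -` T) = V x \<inter> p -` T" if "x \<in> F" for x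
        using V(1)[OF that] openin_imp_subset by blast
      ultimately show ?thesis using \<open>u \<in> v\<close> by (auto simp: v_def)
    qed
    moreover have "pairwise disjnt v"
    proof (rule pairwiseI)
      fix u u' assume "u \<in> v" "u' \<in> v" "u \<noteq> u'"
      then obtain x x' where "x \<in> F" "x' \<in> F" "u = V x \<inter> p -` T" "u' = V x' \<inter> p -` T"
        by (auto simp: v_def)
      then show "disjnt u u'" using disj[of x x'] \<open>u \<noteq> u'\<close> by (auto simp: disjnt_def)
    qed
    moreover have "\<exists>q. homeomorphism u T p q" if "u \<in> v" for u
    proof -
      obtain x where x: "x \<in> F" "u = V x \<inter> p -` T" using \<open>u \<in> v\<close> by (auto simp: v_def)
      obtain q where q: "homeomorphism (W x) (p ` W x) p q" using W x FC by blast
      have "p ` u = T" using TV[OF x(1)] x(2) by blast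
      then have "homeomorphism u T p q"
        using V(3)[OF x(1)] x by (intro homeomorphism_of_subsets[OF q, of u T]) auto
      then show ?thesis by blast
    qed
    ultimately show ?thesis
      using \<open>y \<in> T\<close> opT by (intro exI[of _ T] exI[of _ v] conjI ballI) simp_all
  qed
  ultimately show ?thesis unfolding covering_space_def using contp by simp
qed

section \<open>Quantitative differential calculus\<close>

lemma bounded_bilinear_matrix_vector_mult:
  "bounded_bilinear ((*v) :: real^'n^'m \<Rightarrow> real^'n \<Rightarrow> real^'m)"
  unfolding bilinear_conv_bounded_bilinear[symmetric] bilinear_def
  by (auto intro!: linearI simp: matrix_vector_mult_add_rdistrib matrix_vector_right_distrib
      scaleR_matrix_vector_assoc matrix_vector_mult_scaleR)

text \<open>The inverse of \<open>D a\<close> is the left inverse demanded by the library criterion.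
  What remains is to pass from continuity of \<open>D\<close> in the Euclidean norm of matrices to
  continuity in operator norm; \<open>K\<close> compares the two norms.\<close>

lemma continuously_differentiable_locally_injective:
  fixes f :: "real^'n \<Rightarrow> real^'n"
  assumes "open S" "a \<in> S"
    and der: "\<And>x. x \<in> S \<Longrightarrow> (f has_derivative (*v) (D x)) (at x)"
    and cont: "continuous_on S D"
    and inv: "invertible (D a)"
  obtains r where "r > 0" "ball a r \<subseteq> S" "inj_on f (ball a r)"
proof -
  obtain B where B: "B ** D a = mat 1" using inv unfolding invertible_def by blast
  obtain K where "K > 0" and K: "\<And>(A :: real^'n^'n) v. norm (A *v v) \<le> norm A * norm v * K"
    using bounded_bilinear.pos_bounded[OF bounded_bilinear_matrix_vector_mult] by blast
  show ?thesis
  proof (rule has_derivative_locally_injective[of a S "(*v) B" "\<lambda>x. (*v) (D x)" f])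
    show "(*v) B \<circ> (*v) (D a) = id"
      by (auto simp: fun_eq_iff matrix_vector_mul_assoc B)
    fix e :: real assume "e > 0"
    have "isCont D a" using cont \<open>open S\<close> \<open>a \<in> S\<close> continuous_on_eq_continuous_at by blast
    then obtain d where "d > 0" and d: "\<And>x. dist x a < d \<Longrightarrow> dist (D x) (D a) < e / (2 * K)"
      using \<open>e > 0\<close> \<open>K > 0\<close> unfolding continuous_at_eps_delta
      by (metis divide_pos_pos mult_pos_pos zero_less_numeral)
    have "onorm (\<lambda>v. D x *v v - D a *v v) < e" if "dist a x < d" for x
    proof -
      have "norm (D x *v v - D a *v v) \<le> e / 2 * norm v" for v
      proof -
        have "norm (D x *v v - D a *v v) \<le> norm (D x - D a) * norm v * K"
          using K[of "D x - D a" v] by (simp add: matrix_vector_mult_diff_rdistrib)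
        also have "\<dots> \<le> e / (2 * K) * norm v * K"
          using d[of x] that \<open>K > 0\<close> by (intro mult_right_mono) (auto simp: dist_norm norm_minus_commute)
        finally show ?thesis using \<open>K > 0\<close> by simp
      qed
      then have "onorm (\<lambda>v. D x *v v - D a *v v) \<le> e / 2"
        using \<open>e > 0\<close> by (intro onorm_bound) auto
      then show ?thesis using \<open>e > 0\<close> by simp
    qed
    then show "\<exists>d>0. \<forall>x. dist a x < d \<longrightarrow> onorm (\<lambda>v. D x *v v - D a *v v) < e"
      using \<open>d > 0\<close> by blast
  qed (use assms that in auto)
qed

text \<open>This is the mean value inequality on small balls: \<open>D\<close> is uniformly
  continuous on a compact neighbourhood of \<open>K\<close>, so on each ball it deviates from its
  value at the centre by at most \<open>e\<close> in operator norm.\<close>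

lemma uniform_strict_differentiability:
  fixes f :: "real^'n \<Rightarrow> real^'m"
  assumes "open S" "compact K" "K \<subseteq> S"
    and der: "\<And>x. x \<in> S \<Longrightarrow> (f has_derivative (*v) (D x)) (at x)"
    and cont: "continuous_on S D" and "e > 0"
  obtains d where "d > 0"
    "\<And>x y. x \<in> K \<Longrightarrow> dist x y < d \<Longrightarrow> norm (f y - f x - D x *v (y - x)) \<le> e * norm (y - x)"
proof -
  obtain B where "B > 0" and B: "\<And>(A :: real^'n^'m) v. norm (A *v v) \<le> norm A * norm v * B"
    using bounded_bilinear.pos_bounded[OF bounded_bilinear_matrix_vector_mult] by blast
  obtain \<epsilon> where "\<epsilon> > 0" and \<epsilon>: "(\<Union>x\<in>K. cball x \<epsilon>) \<subseteq> S"
    using compact_subset_open_imp_cball_epsilon_subset[OF \<open>compact K\<close> \<open>open S\<close> \<open>K \<subseteq> S\<close>] by blast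
  \<comment> \<open>The closed \<open>\<epsilon>\<close>-neighbourhood of \<open>K\<close>, written
    as a sum of two compact sets to make its compactness immediate.\<close>
  define L where "L = {x + y | x y. x \<in> K \<and> y \<in> cball 0 \<epsilon>}"
  have "compact L" unfolding L_def using \<open>compact K\<close> by (intro compact_sums) auto
  have L: "z \<in> L" if "x \<in> K" "dist x z \<le> \<epsilon>" for x z
    using that unfolding L_def by (intro CollectI exI[of _ x] exI[of _ "z - x"]) (auto simp: dist_norm norm_minus_commute)
  have "L \<subseteq> S" using \<epsilon> by (force simp: L_def dist_norm)
  then have "uniformly_continuous_on L D"
    using cont \<open>compact L\<close> by (meson compact_uniformly_continuous continuous_on_subset)
  moreover have "e / B > 0" using \<open>e > 0\<close> \<open>B > 0\<close> by simp
  ultimately obtain d where "d > 0" and d: "\<And>x z. x \<in> L \<Longrightarrow> z \<in> L \<Longrightarrow> dist z x < d \<Longrightarrow> dist (D z) (D x) < e / B"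
    unfolding uniformly_continuous_on_def by blast
  show ?thesis
  proof (rule that[of "min d \<epsilon>"])
    show "min d \<epsilon> > 0" using \<open>d > 0\<close> \<open>\<epsilon> > 0\<close> by simp
    fix x y assume x: "x \<in> K" and y: "dist x y < min d \<epsilon>"
    let ?b = "ball x (min d \<epsilon>)"
    have xb: "x \<in> ?b" using \<open>d > 0\<close> \<open>\<epsilon> > 0\<close> by simp
    have sub: "?b \<subseteq> L" using L[OF x] by auto
    have "norm (f y - f x - D x *v (y - x)) \<le> norm (y - x) * e"
    proof (rule differentiable_bound_linearization[where S = ?b and f' = "\<lambda>z. (*v) (D z)"])
      fix t :: real assume "t \<in> {0..1}"
      then have "(1 - t) *\<^sub>R x + t *\<^sub>R y \<in> ?b"
        using convex_ball[of x "min d \<epsilon>"] xb y by (intro convexD_alt) auto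
      then show "x + t *\<^sub>R (y - x) \<in> ?b" by (simp add: algebra_simps)
    next
      fix z assume z: "z \<in> ?b"
      show "(f has_derivative (*v) (D z)) (at z within ?b)"
        using der \<open>L \<subseteq> S\<close> sub z by (blast intro: has_derivative_at_withinI)
      have "norm (D z *v v - D x *v v) \<le> e * norm v" for v
      proof -
        have "norm (D z *v v - D x *v v) \<le> norm (D z - D x) * norm v * B"
          using B[of "D z - D x" v] by (simp add: matrix_vector_mult_diff_rdistrib)
        also have "\<dots> \<le> e / B * norm v * B"
          using d[of x z] z sub xb \<open>B > 0\<close>
          by (intro mult_right_mono) (auto simp: dist_norm norm_minus_commute subset_iff)
        finally show ?thesis using \<open>B > 0\<close> by simp
      qed
      then show "onorm ((*v) (D z) - (*v) (D x)) \<le> e"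
        using \<open>e > 0\<close> by (intro onorm_bound) auto
    qed (fact xb)
    then show "norm (f y - f x - D x *v (y - x)) \<le> e * norm (y - x)" by (simp add: mult.commute)
  qed
qed

lemma continuous_on_matrix_vector_mult:
  fixes D :: "'a::topological_space \<Rightarrow> real^'n^'m"
  assumes "continuous_on S D" "continuous_on S v"
  shows "continuous_on S (\<lambda>x. D x *v v x)"
  using bounded_bilinear.continuous_on[OF bounded_bilinear_matrix_vector_mult assms] .

lemma invertible_imp_matrix_vector_mult_nonzero:
  fixes A :: "real^'n^'n"
  assumes "invertible A" "v \<noteq> 0"
  shows "A *v v \<noteq> 0"
  using assms by (metis invertible_def matrix_left_invertible_ker)

text \<open>The strict inequality keeps the segment from an increment of \<open>f\<close> to its
  linearization away from 0, so the one can be deformed into the other.\<close>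

lemma derivative_dominates_linearization_error:
  fixes f :: "real^'n \<Rightarrow> real^'n"
  assumes "open S" "compact K" "K \<subseteq> S"
    and der: "\<And>x. x \<in> S \<Longrightarrow> (f has_derivative (*v) (D x)) (at x)"
    and cont: "continuous_on S D" and inv: "\<And>x. x \<in> S \<Longrightarrow> invertible (D x)"
  obtains d where "d > 0"
    "\<And>x y. x \<in> K \<Longrightarrow> dist x y < d \<Longrightarrow> y \<noteq> x \<Longrightarrow>
       norm (f y - f x - D x *v (y - x)) < norm (f y - f x)"
proof (cases "K = {}")
  case True
  then show ?thesis using that[of 1] by simp
next
  case False
  let ?Q = "K \<times> sphere (0 :: real^'n) 1"
  have "compact ?Q" using \<open>compact K\<close> by (intro compact_Times) auto
  moreover have "?Q \<noteq> {}" using False by simp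
  moreover have "continuous_on ?Q (\<lambda>z. norm (D (fst z) *v snd z))"
    using \<open>K \<subseteq> S\<close>
    by (intro continuous_on_norm continuous_on_matrix_vector_mult continuous_on_snd continuous_on_id
        continuous_on_compose2[OF cont continuous_on_fst]) auto
  ultimately obtain z where z: "z \<in> ?Q"
    and min: "\<And>w. w \<in> ?Q \<Longrightarrow> norm (D (fst z) *v snd z) \<le> norm (D (fst w) *v snd w)"
    using continuous_attains_inf[of ?Q "\<lambda>z. norm (D (fst z) *v snd z)"] by blast
  \<comment> \<open>\<open>c\<close> is the least factor by which any \<open>D x\<close> with
    \<open>x\<close> in \<open>K\<close> stretches a vector; invertibility makes it
    positive.\<close>
  define c where "c = norm (D (fst z) *v snd z)"
  have "snd z \<noteq> 0" "fst z \<in> S" using z \<open>K \<subseteq> S\<close> by auto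
  then have "c > 0"
    unfolding c_def using inv by (simp add: invertible_imp_matrix_vector_mult_nonzero)
  have lower: "c * norm v \<le> norm (D x *v v)" if "x \<in> K" for x v
  proof (cases "v = 0")
    case False
    then have "c \<le> norm (D x *v ((1 / norm v) *\<^sub>R v))"
      using min[of "(x, (1 / norm v) *\<^sub>R v)"] that by (simp add: c_def)
    then show ?thesis using False by (simp add: matrix_vector_mult_scaleR field_simps)
  qed simp
  \<comment> \<open>An error of at most \<open>c/3\<close> times the distance leaves the increment
    at least \<open>2c/3\<close> times the distance.\<close>
  obtain d where "d > 0" and d: "\<And>x y. x \<in> K \<Longrightarrow> dist x y < d \<Longrightarrow>
      norm (f y - f x - D x *v (y - x)) \<le> c / 3 * norm (y - x)"
    using uniform_strict_differentiability[OF assms(1-3) der cont, of "c / 3"] \<open>c > 0\<close> by auto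
  show ?thesis
  proof (rule that[OF \<open>d > 0\<close>])
    fix x y assume *: "x \<in> K" "dist x y < d" "y \<noteq> x"
    have "norm (D x *v (y - x)) \<le> norm (f y - f x) + norm (f y - f x - D x *v (y - x))"
      using norm_triangle_ineq4[of "f y - f x" "f y - f x - D x *v (y - x)"] by simp
    then have "c * norm (y - x) \<le> norm (f y - f x) + norm (f y - f x - D x *v (y - x))"
      using lower[OF *(1), of "y - x"] by linarith
    moreover have "c * norm (y - x) > 0" using * \<open>c > 0\<close> by simp
    ultimately show "norm (f y - f x - D x *v (y - x)) < norm (f y - f x)"
      using d[OF *(1,2)] by simp
  qed
qed

section \<open>Homotopies of maps avoiding the origin\<close>

lemma homotopic_matrix_vector_mult:
  fixes D E :: "'a::topological_space \<Rightarrow> real^'n^'n"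
  assumes hom: "homotopic_with_canon (\<lambda>_. True) S {A. invertible A} D E"
    and contv: "continuous_on S v" and v: "\<And>x. x \<in> S \<Longrightarrow> v x \<noteq> 0"
  shows "homotopic_with_canon (\<lambda>_. True) S (- {0}) (\<lambda>x. D x *v v x) (\<lambda>x. E x *v v x)"
proof -
  obtain h where h: "continuous_on ({0..1::real} \<times> S) h" "h \<in> {0..1} \<times> S \<rightarrow> {A. invertible A}"
    "\<And>x. h (0, x) = D x" "\<And>x. h (1, x) = E x"
    using hom unfolding homotopic_with_def by auto
  show ?thesis
    unfolding homotopic_with_def
  proof (intro exI[of _ "\<lambda>z. h z *v v (snd z)"] conjI)
    have "continuous_on ({0..1} \<times> S) (\<lambda>z. h z *v v (snd z))"
      by (intro continuous_on_matrix_vector_mult h(1) continuous_on_compose2[OF contv continuous_on_snd]) auto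
    moreover have "h z *v v (snd z) \<noteq> 0" if "z \<in> {0..1} \<times> S" for z
      using that h(2) v by (intro invertible_imp_matrix_vector_mult_nonzero) auto
    ultimately show "continuous_map (prod_topology (top_of_set {0..1}) (top_of_set S)) (top_of_set (- {0}))
        (\<lambda>z. h z *v v (snd z))"
      by auto
  qed (auto simp: h)
qed

text \<open>The argument of Rouche's theorem: the segment from \<open>f x\<close> to
  \<open>g x\<close> stays in a ball around \<open>f x\<close> that is too small to contain
  0.\<close>

lemma homotopic_linear_avoiding_zero:
  fixes f g :: "'a::topological_space \<Rightarrow> 'b::real_normed_vector"
  assumes "continuous_on S f" "continuous_on S g"
    and "\<And>x. x \<in> S \<Longrightarrow> norm (f x - g x) < norm (f x)"
  shows "homotopic_with_canon (\<lambda>_. True) S (- {0}) f g"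
proof (rule homotopic_with_linear)
  fix x assume "x \<in> S"
  have "norm (f x - z) \<le> norm (f x - g x)" if "z \<in> closed_segment (f x) (g x)" for z
    using segment_bound1[OF that] by (simp add: norm_minus_commute)
  then show "closed_segment (f x) (g x) \<subseteq> - {0}"
    using assms(3)[OF \<open>x \<in> S\<close>] by fastforce
qed (use assms in auto)

section \<open>Deforming f to a linear map on small spheres\<close>

text \<open>The part of the argument valid in every dimension from 2 on, where punctured balls are
  connected. The bound \<open>m\<close> on the sphere of radius \<open>R\<close> is what makes
  \<open>f\<close> proper over the punctured ball of radius \<open>m\<close>.\<close>

locale null_homotopic_derivative =
  fixes f :: "real^'n \<Rightarrow> real^'n" and D :: "real^'n \<Rightarrow> real^'n^'n" and A :: "real^'n^'n"
    and R m :: real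
  assumes dim: "2 \<le> CARD('n)" and R: "0 < R" and m: "0 < m"
    and contf: "continuous_on (cball 0 R) f"
    and zero: "\<And>x. x \<in> cball 0 R \<Longrightarrow> f x = 0 \<longleftrightarrow> x = 0"
    and der: "\<And>x. x \<in> ball 0 R - {0} \<Longrightarrow> (f has_derivative (*v) (D x)) (at x)"
    and hom: "homotopic_with_canon (\<lambda>_. True) (ball 0 R - {0}) {A. invertible A} D (\<lambda>_. A)"
    and bound: "\<And>x. norm x = R \<Longrightarrow> m \<le> norm (f x)"
begin

lemma contD: "continuous_on (ball 0 R - {0}) D"
  using hom homotopic_with_imp_continuous by blast

lemma invertible_D: "invertible (D x)" if "x \<in> ball 0 R - {0}"
  using homotopic_with_imp_subset1[OF hom] that by blast

lemma invertible_A: "invertible A"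
proof -
  obtain x :: "real^'n" where "norm x = R / 2" using R vector_choose_size[of "R / 2"] by auto
  then have "x \<in> ball 0 R - {0}" using R by auto
  then show ?thesis using homotopic_with_imp_subset2[OF hom] by blast
qed

lemma small_near_zero:
  assumes "c > 0"
  obtains r where "0 < r" "r < R" "\<forall>x\<in>cball 0 r. norm (f x) < c"
proof -
  have "f 0 = 0" using zero[of 0] R by simp
  moreover have "isCont f 0"
    using contf R by (intro continuous_on_interior[of "cball 0 R"]) auto
  ultimately obtain d where d: "d > 0" "\<And>x. norm x < d \<Longrightarrow> norm (f x) < c"
    using \<open>c > 0\<close> unfolding continuous_at_eps_delta by auto
  show ?thesis
    using that[of "min (d / 2) (R / 2)"] d R by simp
qed

definition V :: "(real^'n) set" where "V = {x \<in> ball 0 R. norm (f x) < m} - {0}"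

text \<open>Properness: points of norm \<open>R\<close> have values of norm at least
  \<open>m\<close>, and 0 has value 0, so a compact set in the punctured target ball has the same
  preimage in \<open>V\<close> as in the compact ball \<open>cball 0 R\<close>.\<close>

lemma covering: "covering_space V f (ball 0 m - {0})"
proof (rule proper_local_homeomorphism_imp_covering_space)
  have V_sub: "V \<subseteq> cball 0 R" by (auto simp: V_def)
  show contV: "continuous_on V f" using contf V_sub continuous_on_subset by blast
  show fV: "f ` V \<subseteq> ball 0 m - {0}" using zero by (auto simp: V_def)
  obtain r where r: "0 < r" "r < R" "\<forall>x\<in>cball 0 r. norm (f x) < m"
    using small_near_zero[OF m] by blast
  obtain x :: "real^'n" where "norm x = r" using r vector_choose_size[of r] by auto
  then have "x \<in> V" using r by (auto simp: V_def)
  then show "V \<noteq> {}" by blast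
  have "aff_dim (ball (0 :: real^'n) m) \<noteq> 1"
    using m dim by (simp add: aff_dim_open)
  then show "connected (ball (0 :: real^'n) m - {0})"
    by (intro connected_punctured_convex convex_ball)
  have "V = (ball 0 R \<inter> f -` ball 0 m) - {0}" by (auto simp: V_def)
  moreover have "open (ball 0 R \<inter> f -` ball 0 m)"
    using contf by (intro continuous_open_preimage) (auto intro: continuous_on_subset)
  ultimately have "open V" by (simp add: open_Diff)
  fix x assume "x \<in> V"
  have VR: "V \<subseteq> ball 0 R - {0}" by (auto simp: V_def)
  obtain e where e: "e > 0" "ball x e \<subseteq> V" "inj_on f (ball x e)"
    using continuously_differentiable_locally_injective[OF \<open>open V\<close> \<open>x \<in> V\<close>, of f D]
      der continuous_on_subset[OF contD VR] invertible_D VR \<open>x \<in> V\<close> by blast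
  have cont: "continuous_on (ball x e) f" using contV e continuous_on_subset by blast
  \<comment> \<open>Local injectivity is enough here: invariance of domain supplies the continuous
    inverse and the openness of the image.\<close>
  obtain q where "homeomorphism (ball x e) (f ` ball x e) f q"
    using invariance_of_domain_homeomorphism[OF open_ball cont _ e(3)] by auto
  moreover have "open (f ` ball x e)"
    using invariance_of_domain[OF cont open_ball e(3)] .
  ultimately show "\<exists>U q. openin (top_of_set V) U \<and> x \<in> U \<and>
                openin (top_of_set (ball 0 m - {0})) (f ` U) \<and> homeomorphism U (f ` U) f q"
    using e fV by (intro exI[of _ "ball x e"] exI[of _ q]) (auto intro!: open_subset)
next
  fix K :: "(real^'n) set" assume K: "K \<subseteq> ball 0 m - {0}" "compact K"
  have "V \<inter> f -` K = cball 0 R \<inter> f -` K"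
  proof -
    have "norm x < R" if "norm x \<le> R" "f x \<in> K" for x
      using bound[of x] K that by force
    moreover have "x \<noteq> 0" if "f x \<in> K" for x using K that zero[of x] R by force
    ultimately show ?thesis using K by (auto simp: V_def)
  qed
  moreover have "closed (cball 0 R \<inter> f -` K)"
    using continuous_closed_preimage[OF contf closed_cball] K compact_imp_closed by blast
  ultimately show "compact (V \<inter> f -` K)"
    by (metis Int_lower1 bounded_cball bounded_subset compact_eq_bounded_closed)
qed

text \<open>A substitute for the flow of the vector field \<open>- df(x)\<^sup>-\<^sup>1 f(x)\<close>, which is merely continuous.\<close>

lemma lift_radial_contraction:
  assumes r: "0 < r" "r < R" "\<forall>x\<in>cball 0 r. norm (f x) < m"
  obtains k T where "0 < T" "T < 1" "continuous_on ({0..1} \<times> sphere 0 r) k"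
    "\<forall>t\<in>{0..1}. \<forall>x\<in>sphere 0 r. f (k (t, x)) = (1 - t * T) *\<^sub>R f x"
    "\<forall>x\<in>sphere 0 r. k (0, x) = x \<and> norm (k (1, x)) < r"
proof -
  let ?C = "cball 0 R - ball (0 :: real^'n) r"
  obtain x0 :: "real^'n" where "norm x0 = r" using r vector_choose_size[of r] by auto
  then have "?C \<noteq> {}" using r by (intro ex_in_conv[THEN iffD1] exI[of _ x0]) auto
  moreover have "compact ?C" by (intro compact_diff) auto
  moreover have "continuous_on ?C (\<lambda>x. norm (f x))"
    using contf by (intro continuous_on_norm) (auto intro: continuous_on_subset)
  ultimately obtain z where z: "z \<in> ?C" "\<And>x. x \<in> ?C \<Longrightarrow> norm (f z) \<le> norm (f x)"
    using continuous_attains_inf[of ?C "\<lambda>x. norm (f x)"] by blast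
  \<comment> \<open>The minimum of \<open>norm (f x)\<close> on the closed shell between radii
    \<open>r\<close> and \<open>R\<close>: a point of \<open>V\<close> with a smaller value must lie
    inside the sphere of radius \<open>r\<close>.\<close>
  define \<mu> where "\<mu> = norm (f z)"
  have "\<mu> > 0" using z zero[of z] r by (auto simp: \<mu>_def)
  \<comment> \<open>Chosen so that \<open>(1 - T) * m < \<mu>\<close>, which puts the endpoints
    \<open>k (1, x)\<close> inside the sphere; the bound \<open>1/2\<close> keeps \<open>T\<close>
    positive.\<close>
  define T where "T = 1 - min (1/2) (\<mu> / (2 * m))"
  have T: "0 < T" "T < 1" using \<open>\<mu> > 0\<close> m by (auto simp: T_def min_def)
  have Tm: "(1 - T) * m < \<mu>"
  proof -
    have "(1 - T) * m \<le> \<mu> / (2 * m) * m"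
      using m by (intro mult_right_mono) (auto simp: T_def)
    then show ?thesis using m \<open>\<mu> > 0\<close> by simp
  qed
  have tT: "0 < 1 - t * T" "1 - t * T \<le> 1" if "t \<in> {0..1}" for t
  proof -
    have "t * T \<le> T" "0 \<le> t * T" using that T by (auto simp: mult_left_le_one_le)
    then show "0 < 1 - t * T" "1 - t * T \<le> 1" using T by linarith+
  qed
  have sphere_V: "sphere 0 r \<subseteq> V" using r by (auto simp: V_def)
  let ?h = "\<lambda>z. (1 - fst z * T) *\<^sub>R f (snd z)"
  \<comment> \<open>Since \<open>1 - t * T\<close> stays positive, the contraction never reaches 0
    and can be lifted, starting from the inclusion of the sphere.\<close>
  obtain k where k: "continuous_on ({0..1} \<times> sphere 0 r) k" "k \<in> {0..1} \<times> sphere 0 r \<rightarrow> V"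
     "\<And>x. x \<in> sphere 0 r \<Longrightarrow> k (0, x) = id x"
     "\<And>z. z \<in> {0..1} \<times> sphere 0 r \<Longrightarrow> ?h z = f (k z)"
  proof (rule covering_space_lift_homotopy[OF covering, of "sphere 0 r" ?h id])
    have "continuous_on (sphere 0 r) f" using contf r by (auto intro: continuous_on_subset)
    then show "continuous_on ({0..1} \<times> sphere 0 r) ?h"
      by (intro continuous_intros continuous_on_compose2[OF _ continuous_on_snd, of _ f]) auto
    have "?h (t, x) \<in> ball 0 m - {0}" if "t \<in> {0..1}" "x \<in> sphere 0 r" for t x
    proof -
      have "f x \<noteq> 0" using zero[of x] that r by auto
      moreover have "(1 - t * T) * norm (f x) < m"
      proof (rule le_less_trans)
        show "(1 - t * T) * norm (f x) \<le> norm (f x)"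
          using tT[OF that(1)] by (intro mult_left_le_one_le) auto
        show "norm (f x) < m" using r(3) that by simp
      qed
      ultimately show ?thesis using tT(1)[OF that(1)] by simp
    qed
    then show "?h \<in> {0..1} \<times> sphere 0 r \<rightarrow> ball 0 m - {0}" by auto
  qed (use sphere_V in auto)
  show ?thesis
  proof (rule that[OF T k(1)]; intro ballI conjI)
    fix t :: real and x :: "real^'n" assume "t \<in> {0..1}" "x \<in> sphere 0 r"
    then show "f (k (t, x)) = (1 - t * T) *\<^sub>R f x" using k(4)[of "(t, x)"] by simp
  next
    fix x :: "real^'n" assume x: "x \<in> sphere 0 r"
    then show "k (0, x) = x" using k(3) by simp
    have "k (1, x) \<in> V" using k(2) x by auto
    have "f (k (1, x)) = (1 - T) *\<^sub>R f x" using k(4)[of "(1, x)"] x by simp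
    then have "norm (f (k (1, x))) = (1 - T) * norm (f x)" using T by simp
    also have "\<dots> \<le> (1 - T) * m" using r(3) x T by (intro mult_left_mono) (auto simp: less_imp_le)
    finally have "norm (f (k (1, x))) < \<mu>" using Tm by simp
    then show "norm (k (1, x)) < r"
      using z(2)[of "k (1, x)"] \<open>k (1, x) \<in> V\<close> by (force simp: \<mu>_def V_def)
  qed
qed

text \<open>Facts 1, 2 and 3 are the first links of the chain. Facts 4 and 5 treat
  \<open>x - k (t, x)\<close> before \<open>A\<close> is applied; they are joined in 6, and
  \<open>A\<close> is composed with the result at the end.\<close>

lemma homotopic_linear_on_sphere:
  assumes r: "0 < r" "r < R" "\<forall>x\<in>cball 0 r. norm (f x) < m"
  shows "homotopic_with_canon (\<lambda>_. True) (sphere 0 r) (- {0}) f ((*v) A)"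
proof -
  obtain k T where T: "0 < T" "T < 1" and contk: "continuous_on ({0..1} \<times> sphere 0 r) k"
    and fk': "\<forall>t\<in>{0..1}. \<forall>x\<in>sphere 0 r. f (k (t, x)) = (1 - t * T) *\<^sub>R f x"
    and k01: "\<forall>x\<in>sphere 0 r. k (0, x) = x \<and> norm (k (1, x)) < r"
    by (rule lift_radial_contraction[OF r]) (rule that; assumption)
  have fk: "f (k (t, x)) = (1 - t * T) *\<^sub>R f x" if "t \<in> {0..1}" "x \<in> sphere 0 r" for t x
    using fk' that by blast
  have k0: "k (0, x) = x" and k1: "norm (k (1, x)) < r" if "x \<in> sphere 0 r" for x
    using k01 that by auto
  have fnz: "f x \<noteq> 0" if "x \<in> sphere 0 r" for x using zero[of x] that r by auto
  \<comment> \<open>The values of \<open>f\<close> at the two points differ, by the factor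
    \<open>1 - t * T\<close>.\<close>
  have k_ne: "k (t, x) \<noteq> x" if "0 < t" "t \<le> 1" "x \<in> sphere 0 r" for t x
  proof
    assume "k (t, x) = x"
    then have "(t * T) *\<^sub>R f x = 0" using fk[of t x] that by (simp add: algebra_simps)
    then show False using that T fnz by simp
  qed
  have sphere_sub: "sphere 0 r \<subseteq> ball 0 R - {0 :: real^'n}" using r by auto
  have "open (ball 0 R - {0 :: real^'n})" by (intro open_Diff) auto
  then obtain d where "d > 0" and d: "\<And>x y. x \<in> sphere 0 r \<Longrightarrow> dist x y < d \<Longrightarrow> y \<noteq> x \<Longrightarrow>
       norm (f y - f x - D x *v (y - x)) < norm (f y - f x)"
    by (rule derivative_dominates_linearization_error[OF _ compact_sphere sphere_sub der contD invertible_D]) blast+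
  \<comment> \<open>Uniform continuity of \<open>k\<close> and \<open>k (0, x) = x\<close> give one
    positive time at which the linearization estimate holds on the whole sphere.\<close>
  obtain t where t: "0 < t" "t \<le> 1" and kt: "\<And>x. x \<in> sphere 0 r \<Longrightarrow> dist x (k (t, x)) < d"
  proof -
    have "uniformly_continuous_on ({0..1} \<times> sphere 0 r) k"
      using contk by (intro compact_uniformly_continuous compact_Times) auto
    then obtain s where "s > 0" and s: "\<And>z w. z \<in> {0..1} \<times> sphere 0 r \<Longrightarrow> w \<in> {0..1} \<times> sphere 0 r \<Longrightarrow>
        dist w z < s \<Longrightarrow> dist (k w) (k z) < d"
      using \<open>d > 0\<close> unfolding uniformly_continuous_on_def by blast
    have "dist x (k (min 1 (s / 2), x)) < d" if "x \<in> sphere 0 r" for x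
      using s[of "(min 1 (s / 2), x)" "(0, x)"] \<open>s > 0\<close> that k0 by (auto simp: dist_Pair_Pair)
    then show ?thesis using that[of "min 1 (s / 2)"] \<open>s > 0\<close> by auto
  qed
  have cont_sphere: "continuous_on (sphere 0 r) f" using contf r by (auto intro: continuous_on_subset)
  have cont_kt: "continuous_on (sphere 0 r) (\<lambda>x. k (u, x))" if "u \<in> {0..1}" for u
    using that by (intro continuous_on_compose2[OF contk]) (auto intro!: continuous_intros)
  have contDs: "continuous_on (sphere 0 r) D"
    using contD sphere_sub continuous_on_subset by blast
  have diff: "f x - f (k (t, x)) = (t * T) *\<^sub>R f x" if "x \<in> sphere 0 r" for x
    using fk[of t x] t that by (simp add: algebra_simps)
  have tT: "0 < t * T" "t * T \<le> 1" using t T by (auto simp: mult_le_one)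
  have 1: "homotopic_with_canon (\<lambda>_. True) (sphere 0 r) (- {0}) f (\<lambda>x. (t * T) *\<^sub>R f x)"
  proof (rule homotopic_linear_avoiding_zero)
    fix x :: "real^'n" assume x: "x \<in> sphere 0 r"
    have "f x - (t * T) *\<^sub>R f x = (1 - t * T) *\<^sub>R f x" by (simp add: algebra_simps)
    then show "norm (f x - (t * T) *\<^sub>R f x) < norm (f x)" using fnz[OF x] tT by simp
  qed (auto intro!: continuous_intros cont_sphere)
  \<comment> \<open>By \<open>diff\<close> the left map is the increment
    \<open>f x - f (k (t, x))\<close>, and \<open>d\<close> controls its distance to the
    linearization.\<close>
  have 2: "homotopic_with_canon (\<lambda>_. True) (sphere 0 r) (- {0})
      (\<lambda>x. (t * T) *\<^sub>R f x) (\<lambda>x. D x *v (x - k (t, x)))"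
  proof (rule homotopic_linear_avoiding_zero)
    fix x :: "real^'n" assume x: "x \<in> sphere 0 r"
    let ?e = "f (k (t, x)) - f x - D x *v (k (t, x) - x)"
    have "(t * T) *\<^sub>R f x - D x *v (x - k (t, x)) = - ?e"
      unfolding diff[OF x, symmetric] by (simp add: matrix_vector_mult_diff_distrib)
    moreover have "norm ?e < norm (f (k (t, x)) - f x)"
      using d[OF x kt[OF x] k_ne[OF t x]] .
    moreover have "norm (f (k (t, x)) - f x) = norm ((t * T) *\<^sub>R f x)"
      unfolding diff[OF x, symmetric] by (rule norm_minus_commute)
    ultimately show "norm ((t * T) *\<^sub>R f x - D x *v (x - k (t, x))) < norm ((t * T) *\<^sub>R f x)"
      by (simp only: norm_minus_cancel)
  qed (use t in \<open>auto intro!: continuous_intros cont_sphere cont_kt contDs continuous_on_matrix_vector_mult\<close>)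
  have 3: "homotopic_with_canon (\<lambda>_. True) (sphere 0 r) (- {0})
      (\<lambda>x. D x *v (x - k (t, x))) (\<lambda>x. A *v (x - k (t, x)))"
  proof (rule homotopic_matrix_vector_mult)
    show "homotopic_with_canon (\<lambda>_. True) (sphere 0 r) {A. invertible A} D (\<lambda>_. A)"
      using hom sphere_sub by (rule homotopic_with_subset_left)
    show "continuous_on (sphere 0 r) (\<lambda>x. x - k (t, x))"
      using t by (intro continuous_intros cont_kt) auto
    show "x - k (t, x) \<noteq> 0" if "x \<in> sphere 0 r" for x
      using k_ne[OF t that] by simp
  qed
  \<comment> \<open>The time runs linearly from \<open>t\<close> to 1 and so stays positive, where
    \<open>k_ne\<close> excludes zeros.\<close>
  have 4: "homotopic_with_canon (\<lambda>_. True) (sphere 0 r) (- {0}) (\<lambda>x. x - k (t, x)) (\<lambda>x. x - k (1, x))"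
    unfolding homotopic_with_def
  proof (intro exI[of _ "\<lambda>z. snd z - k ((1 - fst z) * t + fst z, snd z)"] conjI)
    have u: "0 < (1 - s) * t + s" "(1 - s) * t + s \<le> 1" if "s \<in> {0..1}" for s
    proof -
      have "(1 - s) * (1 - t) \<ge> 0" using that t by simp
      then show "(1 - s) * t + s \<le> 1" by (simp add: algebra_simps)
      show "0 < (1 - s) * t + s"
        using that t by (cases "s = 0") (auto intro: add_nonneg_pos)
    qed
    have "continuous_on ({0..1} \<times> sphere 0 r) (\<lambda>z. snd z - k ((1 - fst z) * t + fst z, snd z))"
      using u by (intro continuous_intros continuous_on_compose2[OF contk]) (auto simp: less_imp_le)
    moreover have "snd z - k ((1 - fst z) * t + fst z, snd z) \<noteq> 0" if "z \<in> {0..1} \<times> sphere 0 r" for z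
      using k_ne[of "(1 - fst z) * t + fst z" "snd z"] u[of "fst z"] that by auto
    ultimately show "continuous_map (prod_topology (top_of_set {0..1}) (top_of_set (sphere 0 r)))
        (top_of_set (- {0})) (\<lambda>z. snd z - k ((1 - fst z) * t + fst z, snd z))"
      by auto
  qed auto
  \<comment> \<open>The identity comes first because the estimate is relative to the first map: the
    difference \<open>k (1, x)\<close> has norm below \<open>r\<close>, the norm of
    \<open>x\<close>.\<close>
  have 5: "homotopic_with_canon (\<lambda>_. True) (sphere 0 r) (- {0}) (\<lambda>x. x) (\<lambda>x. x - k (1, x))"
    using k1 by (intro homotopic_linear_avoiding_zero) (auto intro!: continuous_intros cont_kt)
  have 6: "homotopic_with_canon (\<lambda>_. True) (sphere 0 r) (- {0}) (\<lambda>x. x - k (t, x)) (\<lambda>x. x)"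
    using homotopic_with_trans[OF 4 homotopic_with_symD[OF 5]] .
  have "homotopic_with_canon (\<lambda>_. True) (sphere 0 r) (- {0})
      ((*v) A \<circ> (\<lambda>x. x - k (t, x))) ((*v) A \<circ> (\<lambda>x. x))"
    using invertible_imp_matrix_vector_mult_nonzero[OF invertible_A]
    by (intro homotopic_with_compose_continuous_left[OF 6] matrix_vector_mult_linear_continuous_on) auto
  then have "homotopic_with_canon (\<lambda>_. True) (sphere 0 r) (- {0}) (\<lambda>x. A *v (x - k (t, x))) ((*v) A)"
    by (simp add: o_def)
  then show ?thesis
    using 1 2 3 homotopic_with_trans by blast
qed

end

section \<open>Loops in the punctured plane\<close>

text \<open>Winding numbers classify loops in the punctured plane. Let \<open>q\<close> run round
  the circle as often as \<open>p\<close> winds about 0. As \<open>h\<close> is homotopic to the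
  identity, the image of \<open>q\<close> under \<open>h\<close> has the same winding number, and it
  has the same endpoints as \<open>p\<close>.\<close>

lemma complex_loop_homotopic_image_of_circular_loop:
  fixes h :: "complex \<Rightarrow> complex"
  assumes hom: "homotopic_with_canon (\<lambda>_. True) (sphere 0 (norm a)) (- {0}) h (\<lambda>z. z)"
    and "a \<noteq> 0"
    and p: "path p" "path_image p \<subseteq> - {0}" "pathstart p = h a" "pathfinish p = h a"
  obtains q where "path q" "path_image q \<subseteq> sphere 0 (norm a)" "pathstart q = a" "pathfinish q = a"
    "homotopic_paths (- {0}) p (h \<circ> q)"
proof -
  have "winding_number p 0 \<in> \<int>" using p by (intro integer_winding_number) auto
  then obtain n :: int where n: "winding_number p 0 = of_int n" by (auto elim: Ints_cases)
  \<comment> \<open>The exponential maps this vertical segment to the circle through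
    \<open>a\<close>, traversed \<open>n\<close> times.\<close>
  define l where "l = linepath (Ln a) (Ln a + 2 * of_int n * of_real pi * \<i>)"
  define q where "q = exp \<circ> l"
  have "path l" by (simp add: l_def)
  then have q: "path q"
    unfolding q_def by (intro path_continuous_image continuous_intros)
  have wq: "winding_number q 0 = of_int n"
    using winding_number_compose_exp[OF \<open>path l\<close>] by (simp add: q_def l_def)
  have exp_n: "exp (2 * of_int n * of_real pi * \<i>) = (1 :: complex)"
    by (simp add: exp_eq_1)
  have q0: "pathstart q = a" and q1: "pathfinish q = a"
    using \<open>a \<noteq> 0\<close> exp_n by (simp_all add: q_def l_def pathstart_compose pathfinish_compose exp_add)
  have "norm (q t) = norm a" if "t \<in> {0..1}" for t
  proof -
    have "Re (l t) = ln (norm a)"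
      using \<open>a \<noteq> 0\<close> by (simp add: l_def linepath_def algebra_simps)
    then show ?thesis using \<open>a \<noteq> 0\<close> by (simp add: q_def)
  qed
  then have qs: "path_image q \<subseteq> sphere 0 (norm a)" by (auto simp: path_image_def)
  \<comment> \<open>Only a free homotopy is available, since the base point moves from
    \<open>h a\<close> to \<open>a\<close>; it suffices to compare winding numbers.\<close>
  have "homotopic_loops (- {0}) (h \<circ> q) ((\<lambda>z. z) \<circ> q)"
    unfolding homotopic_loops_def
  proof (rule homotopic_with_compose_continuous_right)
    show "homotopic_with_canon (\<lambda>f. pathfinish (f \<circ> q) = pathstart (f \<circ> q)) (sphere 0 (norm a)) (- {0}) h (\<lambda>z. z)"
      using hom by (rule homotopic_with_mono) (simp add: pathstart_compose pathfinish_compose q0 q1)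
    show "continuous_on {0..1} q" "q \<in> {0..1} \<rightarrow> sphere 0 (norm a)"
      using q qs by (auto simp: path_def path_image_def)
  qed
  then have "winding_number (h \<circ> q) 0 = winding_number q 0"
    using winding_number_homotopic_loops by (force simp: o_def)
  moreover have "path (h \<circ> q)"
    using homotopic_with_imp_continuous[OF hom] qs q
    by (intro path_continuous_image) (auto intro: continuous_on_subset)
  moreover have "0 \<notin> path_image (h \<circ> q)"
    using homotopic_with_imp_subset1[OF hom] qs by (force simp: path_image_compose)
  ultimately have "homotopic_paths (- {0}) p (h \<circ> q)"
    using winding_number_homotopic_paths_eq[of p 0 "h \<circ> q"] p n wq q0 q1
    by (auto simp: pathstart_compose pathfinish_compose)
  then show ?thesis using that q qs q0 q1 by blast
qed

text \<open>Reduction to the complex case: identify the plane isometrically with the complex numbers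
  and undo \<open>A\<close> on the target, which turns the linear map into the identity. The
  isometry preserves circles about 0.\<close>

lemma loop_homotopic_image_of_circular_loop:
  fixes f :: "real^2 \<Rightarrow> real^2"
  assumes hom: "homotopic_with_canon (\<lambda>_. True) (sphere 0 (norm a)) (- {0}) f ((*v) A)"
    and "invertible A" "a \<noteq> 0"
    and p: "path p" "path_image p \<subseteq> - {0}" "pathstart p = f a" "pathfinish p = f a"
  obtains q where "path q" "path_image q \<subseteq> sphere 0 (norm a)" "pathstart q = a" "pathfinish q = a"
    "homotopic_paths (- {0}) p (f \<circ> q)"
proof -
  obtain J :: "real^2 \<Rightarrow> complex" and K where JK: "linear J" "linear K"
    "\<And>x. norm (J x) = norm x" "\<And>y. norm (K y) = norm y" "\<And>x. K (J x) = x" "\<And>y. J (K y) = y"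
    using isomorphisms_UNIV_UNIV[where 'M = "real^2" and 'N = complex] by auto
  obtain B where B: "A ** B = mat 1" "B ** A = mat 1"
    using \<open>invertible A\<close> unfolding invertible_def by blast
  then have "invertible B" unfolding invertible_def by blast
  define \<phi> where "\<phi> x = J (B *v x)" for x
  define \<psi> where "\<psi> z = A *v K z" for z
  have \<phi>\<psi>: "\<psi> (\<phi> x) = x" "\<phi> (\<psi> z) = z" for x z
    by (simp_all add: \<phi>_def \<psi>_def JK matrix_vector_mul_assoc B)
  have cont: "continuous_on S \<phi>" "continuous_on T \<psi>" "continuous_on T K" for S T
  proof -
    have "linear \<phi>" "linear \<psi>"
      using linear_compose[OF matrix_vector_mul_linear JK(1), of B]
        linear_compose[OF JK(2) matrix_vector_mul_linear, of A]
      by (simp_all add: o_def \<phi>_def[abs_def] \<psi>_def[abs_def])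
    with JK(2) show "continuous_on S \<phi>" "continuous_on T \<psi>" "continuous_on T K"
      by (simp_all add: linear_continuous_on linear_conv_bounded_linear)
  qed
  have nz: "x \<noteq> 0 \<Longrightarrow> \<phi> x \<noteq> 0" "z \<noteq> 0 \<Longrightarrow> \<psi> z \<noteq> 0" for x z
    using invertible_imp_matrix_vector_mult_nonzero[OF \<open>invertible A\<close>]
      invertible_imp_matrix_vector_mult_nonzero[OF \<open>invertible B\<close>] JK(3,4)
    unfolding \<phi>_def \<psi>_def by (metis norm_eq_zero)+
  define h where "h = \<phi> \<circ> f \<circ> K"
  have "homotopic_with_canon (\<lambda>_. True) (sphere 0 (norm (J a))) (- {0}) (\<phi> \<circ> (f \<circ> K)) (\<phi> \<circ> ((*v) A \<circ> K))"
    using hom nz cont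
    by (intro homotopic_with_compose_continuous_left[where Y = "- {0}"]
        homotopic_with_compose_continuous_right[where X = "sphere 0 (norm a)"]) (auto simp: JK)
  moreover have "\<phi> \<circ> ((*v) A \<circ> K) = (\<lambda>z. z)" using \<phi>\<psi>(2) by (auto simp: \<psi>_def)
  ultimately have "homotopic_with_canon (\<lambda>_. True) (sphere 0 (norm (J a))) (- {0}) h (\<lambda>z. z)"
    by (simp add: h_def o_assoc)
  moreover have "J a \<noteq> 0" using \<open>a \<noteq> 0\<close> JK(3) by (metis norm_eq_zero)
  moreover have "path (\<phi> \<circ> p)" using p cont by (intro path_continuous_image)
  moreover have "path_image (\<phi> \<circ> p) \<subseteq> - {0}" 
    unfolding path_image_compose using p(2) nz(1) by fastforce
  ultimately obtain q where q: "path q" "path_image q \<subseteq> sphere 0 (norm (J a))" "pathstart q = J a"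
    "pathfinish q = J a" "homotopic_paths (- {0}) (\<phi> \<circ> p) (h \<circ> q)"
    using p by (rule_tac complex_loop_homotopic_image_of_circular_loop[of "J a" h "\<phi> \<circ> p"])
      (auto simp: pathstart_compose pathfinish_compose h_def JK)
  show ?thesis
  proof (rule that[of "K \<circ> q"])
    show "path (K \<circ> q)" using q cont by (intro path_continuous_image)
    show "path_image (K \<circ> q) \<subseteq> sphere 0 (norm a)" using q(2) JK by (auto simp: path_image_compose)
    show "pathstart (K \<circ> q) = a" "pathfinish (K \<circ> q) = a"
      using q JK by (auto simp: pathstart_compose pathfinish_compose)
    have "homotopic_paths (- {0}) (\<psi> \<circ> (\<phi> \<circ> p)) (\<psi> \<circ> (h \<circ> q))"
      using q(5) cont nz by (intro homotopic_paths_continuous_image) auto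
    then show "homotopic_paths (- {0}) p (f \<circ> (K \<circ> q))"
      by (simp add: o_def h_def \<phi>\<psi>)
  qed
qed

text \<open>The radial retraction \<open>\<rho>\<close> pushes the homotopy into the closed ball of
  radius \<open>s\<close> without reaching 0, and it fixes both paths.\<close>

lemma homotopic_paths_in_punctured_ball:
  fixes p q :: "real \<Rightarrow> 'a::real_normed_vector"
  assumes hom: "homotopic_paths (- {0}) p q" and "0 < s" "s < m"
    and "path_image p \<subseteq> cball 0 s" "path_image q \<subseteq> cball 0 s"
  shows "homotopic_paths (ball 0 m - {0}) p q"
proof -
  define \<rho> :: "'a \<Rightarrow> 'a" where "\<rho> x = min 1 (s / norm x) *\<^sub>R x" for x
  have cont: "continuous_on (- {0}) \<rho>"
    unfolding \<rho>_def by (intro continuous_intros) auto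
  have "\<rho> \<in> - {0} \<rightarrow> ball 0 m - {0}"
  proof
    fix x :: 'a assume "x \<in> - {0}"
    then have "norm (\<rho> x) \<le> s" "\<rho> x \<noteq> 0"
      using \<open>0 < s\<close> by (auto simp: \<rho>_def min_def field_simps)
    then show "\<rho> x \<in> ball 0 m - {0}" using \<open>s < m\<close> by simp
  qed
  then have H: "homotopic_paths (ball 0 m - {0}) (\<rho> \<circ> p) (\<rho> \<circ> q)"
    using homotopic_paths_continuous_image[OF hom cont] by blast
  have fix_ball: "\<rho> x = x" if "norm x \<le> s" for x
    using that \<open>0 < s\<close> by (cases "x = 0") (auto simp: \<rho>_def min_def field_simps)
  have *: "homotopic_paths (ball 0 m - {0}) r (\<rho> \<circ> r)"
    if "path r" "path_image r \<subseteq> - {0}" "path_image r \<subseteq> cball 0 s" for r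
    using that \<open>s < m\<close> fix_ball
    by (intro homotopic_paths_eq) (force simp: path_image_def)+
  have "homotopic_paths (ball 0 m - {0}) p (\<rho> \<circ> p)" "homotopic_paths (ball 0 m - {0}) q (\<rho> \<circ> q)"
    using * homotopic_paths_imp_path[OF hom] homotopic_paths_imp_subset[OF hom] assms(4,5) by auto
  with H show ?thesis
    by (meson homotopic_paths_sym homotopic_paths_trans)
qed

section \<open>Injectivity by monodromy, and the conclusion\<close>

text \<open>If \<open>f a = f b\<close>, a path from \<open>a\<close> to \<open>b\<close> has a loop
  as its image, which is homotopic to the image of a closed loop \<open>q\<close> at
  \<open>a\<close>. Both paths lift homotopic loops from the same starting point, so they end at the
  same point, which is \<open>a\<close>.\<close>

lemma injective_near_zero:
  fixes f :: "real^2 \<Rightarrow> real^2"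
  assumes "null_homotopic_derivative f D A R m"
  obtains r where "0 < r" "r < R" "inj_on f (ball 0 r)"
proof -
  interpret null_homotopic_derivative f D A R m by fact
  \<comment> \<open>The bound \<open>m / 2\<close> leaves room to push homotopies into a closed ball
    inside \<open>ball 0 m\<close>.\<close>
  obtain r where r: "0 < r" "r < R" and small: "\<forall>x\<in>cball 0 r. norm (f x) < m / 2"
    using small_near_zero[of "m / 2"] m by (metis half_gt_zero)
  have small_m: "\<forall>x\<in>cball 0 r. norm (f x) < m" using small m by fastforce
  have image: "path (f \<circ> \<gamma>)" "path_image (f \<circ> \<gamma>) \<subseteq> cball 0 (m / 2) - {0}" "path_image \<gamma> \<subseteq> V"
    if "path \<gamma>" "path_image \<gamma> \<subseteq> cball 0 r - {0}" for \<gamma>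
  proof -
    have "path_image \<gamma> \<subseteq> cball 0 R" using that r by force
    then show "path (f \<circ> \<gamma>)"
      using that contf by (intro path_continuous_image) (auto intro: continuous_on_subset)
    have fx: "f x \<in> cball 0 (m / 2) - {0}" and xV: "x \<in> V" if "x \<in> cball 0 r - {0}" for x
    proof -
      have "norm (f x) < m / 2" "norm (f x) < m" using that small small_m by blast+
      moreover have "x \<in> cball 0 R" "x \<noteq> 0" "norm x < R" using that r by auto
      ultimately show "f x \<in> cball 0 (m / 2) - {0}" "x \<in> V" using zero by (auto simp: V_def)
    qed
    show "path_image (f \<circ> \<gamma>) \<subseteq> cball 0 (m / 2) - {0}"
      unfolding path_image_compose using that(2) fx by (meson image_subsetI subsetD)
    show "path_image \<gamma> \<subseteq> V" using that(2) xV by (meson subsetD subsetI)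
  qed
  have "b = a" if "a \<in> ball 0 r" "b \<in> ball 0 r" "f a = f b" for a b
  proof (cases "a = 0 \<or> b = 0")
    case True
    moreover have "f a = 0 \<longleftrightarrow> a = 0" "f b = 0 \<longleftrightarrow> b = 0"
      using that(1,2) r by (simp_all add: zero)
    ultimately show ?thesis using that(3) by auto
  next
    case False
    have "aff_dim (cball (0 :: real^2) r) \<noteq> 1"
      using r by (simp add: aff_dim_cball)
    then have "path_connected (cball (0 :: real^2) r - {0})"
      by (intro path_connected_punctured_convex convex_cball)
    moreover have "a \<in> cball 0 r - {0}" "b \<in> cball 0 r - {0}" using that False by auto
    ultimately obtain \<gamma> where \<gamma>: "path \<gamma>" "path_image \<gamma> \<subseteq> cball 0 r - {0}"
      "pathstart \<gamma> = a" "pathfinish \<gamma> = b"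
      unfolding path_connected_def by blast
    note \<gamma>' = image[OF \<gamma>(1,2)]
    \<comment> \<open>The sphere used is the one through \<open>a\<close>, so that the circular loop
      can be based at \<open>a\<close>.\<close>
    have a: "a \<noteq> 0" "0 < norm a" "norm a < r" using that False by auto
    then have hom_A: "homotopic_with_canon (\<lambda>_. True) (sphere 0 (norm a)) (- {0}) f ((*v) A)"
      using r small_m by (intro homotopic_linear_on_sphere) auto
    have "path_image (f \<circ> \<gamma>) \<subseteq> - {0}" "pathstart (f \<circ> \<gamma>) = f a" "pathfinish (f \<circ> \<gamma>) = f a"
      using \<gamma>'(2) \<gamma>(3,4) that(3) by (auto simp: pathstart_compose pathfinish_compose)
    then obtain q where q: "path q" "path_image q \<subseteq> sphere 0 (norm a)" "pathstart q = a" "pathfinish q = a"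
      and hom_q: "homotopic_paths (- {0}) (f \<circ> \<gamma>) (f \<circ> q)"
      by (rule loop_homotopic_image_of_circular_loop[OF hom_A invertible_A a(1) \<gamma>'(1)])
    have "path_image q \<subseteq> cball 0 r - {0}" using q(2) a by auto
    note q' = image[OF q(1) this]
    have hom_m: "homotopic_paths (ball 0 m - {0}) (f \<circ> \<gamma>) (f \<circ> q)"
      using q'(2) \<gamma>'(2) m by (intro homotopic_paths_in_punctured_ball[OF hom_q, of "m / 2"]) auto
    have "pathfinish \<gamma> = pathfinish q"
    proof (rule covering_space_monodromy[OF covering \<gamma>'(1) _ q'(1) _ hom_m \<gamma>(1) \<gamma>'(3) _ q(1) q'(3)])
      show "path_image (f \<circ> \<gamma>) \<subseteq> ball 0 m - {0}" "path_image (f \<circ> q) \<subseteq> ball 0 m - {0}"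
        using homotopic_paths_imp_subset[OF hom_m] by auto
      show "pathstart \<gamma> = pathstart q" using \<gamma> q by simp
    qed simp_all
    then show ?thesis using \<gamma> q by simp
  qed
  then have "inj_on f (ball 0 r)" by (auto intro!: inj_onI)
  with r show ?thesis using that by blast
qed

theorem proposition7p1:
  fixes f :: "real^2 \<Rightarrow> real^2"
  assumes "continuous_tame_germ f"
    and "f 0 = 0"
    and "\<exists>r>0. B_hat f \<inter> ball 0 r = {0}"
    and "\<exists>r>0. f -` {0} \<inter> ball 0 r = {0}"
    and "null_homotopic_differential f"
  shows "homeomorphism_germ f"
proof -
  obtain U where "open U" "0 \<in> U" and contU: "continuous_on U f"
    using assms(1) unfolding continuous_tame_germ_def by blast
  then obtain r0 where r0: "r0 > 0" "cball 0 r0 \<subseteq> U"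
    using open_contains_cball by blast
  obtain r1 where r1: "r1 > 0" "f -` {0} \<inter> ball 0 r1 = {0}" using assms(4) by blast
  obtain r2 A where r2: "r2 > 0" "\<And>x. x \<in> ball 0 r2 - {0} \<Longrightarrow> f differentiable (at x)"
    and hom: "homotopic_with_canon (\<lambda>_. True) (ball 0 r2 - {0}) GL2 (\<lambda>x. jacobian f (at x)) (\<lambda>_. A)"
    using assms(5) unfolding null_homotopic_differential_def by blast
  \<comment> \<open>Halving \<open>r1\<close> puts the closed ball of radius \<open>R\<close> inside
    the open ball on which 0 is the only zero.\<close>
  define R where "R = min r0 (min (r1 / 2) r2)"
  have R: "0 < R" "R \<le> r0" "R < r1" "R \<le> r2" using r0 r1 r2 by (auto simp: R_def)
  have contR: "continuous_on (cball 0 R) f"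
    using contU r0 R by (meson continuous_on_subset subset_cball subset_trans)
  have zero: "f x = 0 \<longleftrightarrow> x = 0" if "x \<in> cball 0 R" for x
  proof -
    have "x \<in> f -` {0} \<inter> ball 0 r1 \<longleftrightarrow> x \<in> {0}" unfolding r1(2) ..
    then show ?thesis using that R by simp
  qed
  have "continuous_on (sphere 0 R) (\<lambda>x. norm (f x))"
    using contR by (intro continuous_on_norm) (auto intro: continuous_on_subset)
  \<comment> \<open>The minimum of \<open>norm (f x)\<close> on the sphere serves as the constant
    \<open>m\<close> of the locale.\<close>
  then obtain z where z: "z \<in> sphere 0 R" "\<And>x. x \<in> sphere 0 R \<Longrightarrow> norm (f z) \<le> norm (f x)"
    using continuous_attains_inf[of "sphere 0 R" "\<lambda>x. norm (f x)"] R(1) by auto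
  have "null_homotopic_derivative f (\<lambda>x. jacobian f (at x)) A R (norm (f z))"
  proof
    show "homotopic_with_canon (\<lambda>_. True) (ball 0 R - {0}) {A. invertible A} (\<lambda>x. jacobian f (at x)) (\<lambda>_. A)"
      using hom R(4) unfolding GL2_def by (rule_tac homotopic_with_subset_left) auto
    show "(f has_derivative (*v) (jacobian f (at x))) (at x)" if "x \<in> ball 0 R - {0}" for x
      using r2(2)[of x] that R(4) by (auto simp: jacobian_works)
    show "0 < norm (f z)" using z(1) zero[of z] R(1) by auto
  qed (use R zero z contR in auto)
  then obtain r where r: "0 < r" "r < R" "inj_on f (ball 0 r)"
    by (rule injective_near_zero)
  have cont: "continuous_on (ball 0 r) f"
    using contR r by (auto intro: continuous_on_subset)
  obtain g where "homeomorphism (ball 0 r) (f ` ball 0 r) f g"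
    using invariance_of_domain_homeomorphism[OF open_ball cont _ r(3)] by auto
  moreover have "open (f ` ball 0 r)"
    using invariance_of_domain[OF cont open_ball r(3)] .
  moreover have "0 \<in> f ` ball 0 r" using assms(2) r(1) by force
  ultimately show ?thesis
    unfolding homeomorphism_germ_def using r(1)
    by (intro exI[of _ "ball 0 r"] exI[of _ "f ` ball 0 r"] exI[of _ g] conjI) simp_all
qed

end
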